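(* Let $(X_j:j\ge 1)$ be an i.i.d. sequence of random variables for which there exists $\varepsilon>0$ such that $\mathbb{E}\exp(\varepsilon|X_1|)<\infty$, and with $\mathbb{E}X_1<0$. Let $S_0=0$ and $S_n=X_1+\cdots+X_n$ for $n\ge 1$. Suppose that $(\xi_j:j\ge 0)$ is a sequence, independent of $(S_j:j\ge 0)$, of i.i.d. random variables having a continuous hazard rate function $h(\cdot)$ such that $h(x)\to 0$ as $x\to\infty$. Let $M_\infty=\max\{S_k+\xi_k:k\ge 0\}$. Then $$\mathbb{P}(M_\infty>x)\sim\frac{1}{|\mathbb{E}X_1|}\int_x^\infty\mathbb{P}(\xi_1>y)\,dy\qquad\text{as } x\to\infty.$$
   Context: All random variables are real-valued. The hazard rate function of $\xi_1$ is $h(x)=p(x)/\mathbb{P}(\xi_1>x)$, where $p$ is the density of $\xi_1$; thus $\mathbb{P}(\xi_1>x+y)=\mathbb{P}(\xi_1>x)\exp\left(-\int_0^y h(x+u)\,du\right)$ for $y\ge 0$. The notation $a(x)\sim b(x)$ as $x\to\infty$ means $a(x)/b(x)\to 1$ as $x\to\infty$. *)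

theory Defs
  imports "HOL-Probability.Probability"
begin

definition partial_sum :: "(nat \<Rightarrow> 'a \<Rightarrow> real) \<Rightarrow> nat \<Rightarrow> 'a \<Rightarrow> real" where
  "partial_sum X n \<omega> = (\<Sum>j=1..n. X j \<omega>)"

definition upper_tail :: "'a measure \<Rightarrow> ('a \<Rightarrow> real) \<Rightarrow> real \<Rightarrow> real" where
  "upper_tail P Y x = measure P {\<omega> \<in> space P. Y \<omega> > x}"

(* A density is determined only almost everywhere, so a hazard rate is a relation: h is the
   quotient formed with some version p of the density.  The tail is required to be positive
   everywhere because the quotient has no meaning where it vanishes (and division by zero
   is 0 here). *)
definition has_hazard_rate :: "'a measure \<Rightarrow> ('a \<Rightarrow> real) \<Rightarrow> (real \<Rightarrow> real) \<Rightarrow> bool" where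
  "has_hazard_rate P Y h \<longleftrightarrow>
     (\<exists>p :: real \<Rightarrow> real.
        (\<forall>x. 0 \<le> p x) \<and> distributed P lborel Y (\<lambda>x. ennreal (p x)) \<and>
        (\<forall>x. 0 < upper_tail P Y x) \<and> (\<forall>x. h x = p x / upper_tail P Y x))"

end

theory Submission
  imports Defs
begin

text \<open>
  Write \<open>G\<close> for the tail of \<open>\<xi>\<close>, \<open>V x\<close> for its integral over \<open>[x, \<infinity>)\<close> and \<open>\<mu> = -E X\<close>. A vanishing hazard
  rate makes \<open>G\<close> decay more slowly than any exponential, so that \<open>G (x - B) = o(V x)\<close> and
  \<open>V (x + B) \<sim> V x\<close> for fixed \<open>B\<close>, and the sum of \<open>G (x + c k)\<close> over \<open>k\<close> is \<open>V x / c\<close> up to \<open>G x\<close>.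

  Lower bound: for \<open>c > \<mu>\<close> a Chernoff bound shows that, with probability at least \<open>1 - \<delta>\<close>, the walk
  stays above the line \<open>-c k - B\<close> for ever; independently of this, some \<open>\<xi>\<^sub>k\<close> exceeds \<open>x + B + c k\<close>
  with probability at least \<open>1 - exp (-V (x + B) / c)\<close>. Since \<open>M\<close> is finite, the same estimate with
  finitely many \<open>k\<close> forces \<open>G\<close> to be integrable.

  Upper bound: by the union bound it suffices to estimate \<open>E G (x - S\<^sub>k)\<close>. For \<open>c < \<mu>\<close> the
  contribution of \<open>S\<^sub>k > -c k + B\<close> is at most \<open>G (x - B + c k)\<close> times a constant multiple of
  \<open>exp (-\<theta> B) E (exp (\<theta> (S\<^sub>k + c k)))\<close>, because \<open>G\<close> grows backwards by at most a constant times
  \<open>exp (\<theta> z)\<close> over a distance \<open>z\<close>; a suitable \<open>\<theta>\<close> makes this moment at most \<open>1\<close>, and then a large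
  \<open>B\<close> makes the contribution negligible uniformly in \<open>k\<close>.
\<close>

subsection \<open>Exponential moments of a walk with negative drift\<close>

text \<open>Taylor expansion to second order with Lagrange remainder. Half of the exponent
  \<open>\<epsilon> * \<bar>y\<bar>\<close> absorbs the factor \<open>exp t\<close> of the
  remainder, which is possible because \<open>\<theta> \<le> \<epsilon> / 2\<close>; the other half
  absorbs the square of \<open>y\<close>. The coefficient of the remainder is then free of
  \<open>\<theta>\<close> and has finite expectation under the exponential moment
  hypothesis.\<close>

lemma exp_le_quadratic_exp:
  fixes \<epsilon> \<theta> y :: real
  assumes "0 < \<epsilon>" "0 \<le> \<theta>" "\<theta> \<le> \<epsilon> / 2"
  shows "exp (\<theta> * y) \<le> 1 + \<theta> * y + \<theta>\<^sup>2 * (4 / \<epsilon>\<^sup>2 * exp (\<epsilon> * \<bar>y\<bar>))"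
proof -
  obtain t where t: "\<bar>t\<bar> \<le> \<bar>\<theta> * y\<bar>"
    "exp (\<theta> * y) = (\<Sum>m<2. (\<theta> * y) ^ m / fact m) + exp t / fact 2 * (\<theta> * y) ^ 2"
    using Maclaurin_exp_le by blast
  define u where "u = \<epsilon> * \<bar>y\<bar> / 2"
  have u: "0 \<le> u" using assms by (simp add: u_def)
  have "u\<^sup>2 / 2 \<le> exp u"
    using exp_lower_Taylor_quadratic[OF u] u by linarith
  moreover have "y\<^sup>2 = 4 / \<epsilon>\<^sup>2 * u\<^sup>2"
    using assms by (simp add: u_def power_mult_distrib power_divide field_simps)
  ultimately have y2: "y\<^sup>2 / 2 \<le> 4 / \<epsilon>\<^sup>2 * exp u"
    using mult_left_mono[of "u\<^sup>2 / 2" "exp u" "4 / \<epsilon>\<^sup>2"] by simp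
  have "t \<le> u"
  proof -
    have "\<bar>\<theta> * y\<bar> \<le> \<epsilon> / 2 * \<bar>y\<bar>"
      unfolding abs_mult using assms by (intro mult_right_mono) auto
    then show ?thesis using t(1) by (simp add: u_def)
  qed
  then have "exp t * (y\<^sup>2 / 2) \<le> exp u * (4 / \<epsilon>\<^sup>2 * exp u)"
    using y2 by (intro mult_mono) auto
  also have "\<dots> = 4 / \<epsilon>\<^sup>2 * exp (\<epsilon> * \<bar>y\<bar>)"
    by (simp add: u_def flip: exp_add)
  finally have "\<theta>\<^sup>2 * (exp t * (y\<^sup>2 / 2)) \<le> \<theta>\<^sup>2 * (4 / \<epsilon>\<^sup>2 * exp (\<epsilon> * \<bar>y\<bar>))"
    by (intro mult_left_mono) auto
  then show ?thesis
    using t(2) by (simp add: eval_nat_numeral mult_ac)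
qed

lemma (in prob_space) integrable_if_exp_moment:
  fixes Y :: "'a \<Rightarrow> real"
  assumes [measurable]: "Y \<in> borel_measurable M"
    and "0 < \<epsilon>" "integrable M (\<lambda>\<omega>. exp (\<epsilon> * \<bar>Y \<omega>\<bar>))"
  shows "integrable M Y"
proof (rule Bochner_Integration.integrable_bound)
  show "integrable M (\<lambda>\<omega>. exp (\<epsilon> * \<bar>Y \<omega>\<bar>) / \<epsilon>)" using assms(3) by simp
  have "\<bar>y\<bar> \<le> exp (\<epsilon> * \<bar>y\<bar>) / \<epsilon>" for y
  proof -
    have "\<epsilon> * \<bar>y\<bar> \<le> exp (\<epsilon> * \<bar>y\<bar>)"
      using exp_ge_add_one_self[of "\<epsilon> * \<bar>y\<bar>"] by linarith
    then show ?thesis using \<open>0 < \<epsilon>\<close> by (simp add: field_simps)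
  qed
  then show "AE \<omega> in M. norm (Y \<omega>) \<le> norm (exp (\<epsilon> * \<bar>Y \<omega>\<bar>) / \<epsilon>)"
    using \<open>0 < \<epsilon>\<close> by simp
qed simp

text \<open>The moment generating function equals 1 at 0 and has negative slope there. The quadratic
  bound above replaces differentiation under the expectation: the moment is at most
  \<open>1 + \<theta> * expectation Y + \<theta>\<^sup>2 * K\<close>, which drops below 1 for small
  \<open>\<theta>\<close>.\<close>

lemma (in prob_space) exp_moment_less_1:
  fixes Y :: "'a \<Rightarrow> real"
  assumes [measurable]: "Y \<in> borel_measurable M"
    and "0 < \<epsilon>" and int: "integrable M (\<lambda>\<omega>. exp (\<epsilon> * \<bar>Y \<omega>\<bar>))"
    and "expectation Y < 0"
  shows "\<exists>\<theta>>0. integrable M (\<lambda>\<omega>. exp (\<theta> * Y \<omega>)) \<and> expectation (\<lambda>\<omega>. exp (\<theta> * Y \<omega>)) < 1"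
proof -
  define K where "K = 4 / \<epsilon>\<^sup>2 * expectation (\<lambda>\<omega>. exp (\<epsilon> * \<bar>Y \<omega>\<bar>))"
  have "K \<ge> 0" by (simp add: K_def)
  \<comment> \<open>The first entry makes the quadratic bound applicable, the second makes the
    linear term beat the quadratic one. Dividing by \<open>K + 1\<close> keeps the denominator
    positive and makes that comparison strict.\<close>
  define \<theta> where "\<theta> = min (\<epsilon> / 2) (- expectation Y / (K + 1))"
  have "0 < - expectation Y / (K + 1)"
    using \<open>expectation Y < 0\<close> \<open>K \<ge> 0\<close> by (intro divide_pos_pos) auto
  then have \<theta>: "0 < \<theta>" "\<theta> \<le> \<epsilon> / 2"
    using \<open>0 < \<epsilon>\<close> by (simp_all only: \<theta>_def min_less_iff_conj min.cobounded1 half_gt_zero)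
  have intY: "integrable M Y" using assms(1) \<open>0 < \<epsilon>\<close> int by (rule integrable_if_exp_moment)
  let ?U = "\<lambda>\<omega>. 1 + \<theta> * Y \<omega> + \<theta>\<^sup>2 * (4 / \<epsilon>\<^sup>2 * exp (\<epsilon> * \<bar>Y \<omega>\<bar>))"
  have le: "exp (\<theta> * y) \<le> 1 + \<theta> * y + \<theta>\<^sup>2 * (4 / \<epsilon>\<^sup>2 * exp (\<epsilon> * \<bar>y\<bar>))" for y
    using exp_le_quadratic_exp[of \<epsilon> \<theta> y] \<theta> \<open>0 < \<epsilon>\<close> by simp
  have intU: "integrable M ?U" using intY int by auto
  have int_exp: "integrable M (\<lambda>\<omega>. exp (\<theta> * Y \<omega>))"
  proof (rule Bochner_Integration.integrable_bound[OF intU])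
    show "AE \<omega> in M. norm (exp (\<theta> * Y \<omega>)) \<le> norm (?U \<omega>)"
      using le by (intro AE_I2) (metis abs_ge_self exp_ge_zero abs_of_nonneg order_trans real_norm_def)
  qed simp
  have "expectation (\<lambda>\<omega>. exp (\<theta> * Y \<omega>)) \<le> expectation ?U"
    using int_exp intU le by (intro integral_mono) auto
  also have "\<dots> = 1 + \<theta> * expectation Y + \<theta>\<^sup>2 * K"
    using intY int by (simp add: K_def prob_space)
  also have "\<theta>\<^sup>2 * K < \<theta> * (- expectation Y)"
  proof -
    have "\<theta> * K < \<theta> * (K + 1)" using \<theta> by simp
    also have "\<dots> \<le> - expectation Y / (K + 1) * (K + 1)"
      using \<open>K \<ge> 0\<close> by (intro mult_right_mono) (auto simp: \<theta>_def)
    also have "\<dots> = - expectation Y" using \<open>K \<ge> 0\<close> by simp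
    finally have "\<theta> * (\<theta> * K) < \<theta> * (- expectation Y)"
      by (rule mult_strict_left_mono[OF _ \<theta>(1)])
    then show ?thesis by (simp only: power2_eq_square mult.assoc)
  qed
  finally show ?thesis using \<theta> int_exp by auto
qed

text \<open>The exponential of the sum is a product of independent factors with the same law. With
  nonnegative integrals the product formula requires no separate integrability proof for the
  product.\<close>

lemma (in prob_space) nn_integral_exp_partial_sum:
  fixes X :: "nat \<Rightarrow> 'a \<Rightarrow> real"
  assumes ind: "indep_vars (\<lambda>_. borel) X {1..}"
    and id: "\<And>j. j \<ge> 1 \<Longrightarrow> distr M borel (X j) = distr M borel (X 1)"
    and int: "integrable M (\<lambda>\<omega>. exp (\<theta> * (X 1 \<omega> + c)))"
  shows "(\<integral>\<^sup>+\<omega>. ennreal (exp (\<theta> * (partial_sum X k \<omega> + c * real k))) \<partial>M)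
    = ennreal (expectation (\<lambda>\<omega>. exp (\<theta> * (X 1 \<omega> + c))) ^ k)"
proof -
  have X[measurable]: "X j \<in> borel_measurable M" if "j \<ge> 1" for j
    using ind that by (auto simp: indep_vars_def2)
  let ?f = "\<lambda>x. ennreal (exp (\<theta> * (x + c)))"
  have one: "(\<integral>\<^sup>+\<omega>. ?f (X j \<omega>) \<partial>M) = ennreal (expectation (\<lambda>\<omega>. exp (\<theta> * (X 1 \<omega> + c))))"
    if "j \<ge> 1" for j
  proof -
    have "(\<integral>\<^sup>+\<omega>. ?f (X j \<omega>) \<partial>M) = (\<integral>\<^sup>+x. ?f x \<partial>distr M borel (X j))"
      using that by (subst nn_integral_distr) auto
    also have "\<dots> = (\<integral>\<^sup>+x. ?f x \<partial>distr M borel (X 1))"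
      using id[OF that] by simp
    also have "\<dots> = (\<integral>\<^sup>+\<omega>. ?f (X 1 \<omega>) \<partial>M)"
      by (subst nn_integral_distr) auto
    also have "\<dots> = ennreal (expectation (\<lambda>\<omega>. exp (\<theta> * (X 1 \<omega> + c))))"
      using int by (intro nn_integral_eq_integral) auto
    finally show ?thesis .
  qed
  have "exp (\<theta> * (partial_sum X k \<omega> + c * real k)) = (\<Prod>j=1..k. exp (\<theta> * (X j \<omega> + c)))" for \<omega>
    by (simp add: partial_sum_def sum.distrib flip: exp_sum sum_distrib_left)
  then have "(\<integral>\<^sup>+\<omega>. ennreal (exp (\<theta> * (partial_sum X k \<omega> + c * real k))) \<partial>M)
    = (\<integral>\<^sup>+\<omega>. (\<Prod>j=1..k. ?f (X j \<omega>)) \<partial>M)"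
    by (simp add: prod_ennreal)
  also have "\<dots> = (\<Prod>j=1..k. \<integral>\<^sup>+\<omega>. ?f (X j \<omega>) \<partial>M)"
  proof (rule indep_vars_nn_integral)
    have "indep_vars (\<lambda>_. borel) X {1..k}" using ind by (rule indep_vars_subset) auto
    then show "indep_vars (\<lambda>_. borel) (\<lambda>j \<omega>. ?f (X j \<omega>)) {1..k}"
      by (rule indep_vars_compose2) auto
  qed auto
  also have "\<dots> = (\<Prod>j=1..k. ennreal (expectation (\<lambda>\<omega>. exp (\<theta> * (X 1 \<omega> + c)))))"
    by (intro prod.cong one) auto
  finally show ?thesis by (simp add: ennreal_power)
qed

text \<open>\<open>exp_moment_less_1\<close> is applied to the increment \<open>X 1 + c\<close>,
  whose mean is still negative; the shift costs only the factor
  \<open>exp (\<epsilon> * \<bar>c\<bar>)\<close> in the moment condition. A single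
  \<open>\<theta>\<close> serves all \<open>k\<close>, with geometric decay.\<close>

lemma (in prob_space) drifted_partial_sum_exp_moments:
  fixes X :: "nat \<Rightarrow> 'a \<Rightarrow> real"
  assumes ind: "indep_vars (\<lambda>_. borel) X {1..}"
    and id: "\<And>j. j \<ge> 1 \<Longrightarrow> distr M borel (X j) = distr M borel (X 1)"
    and "0 < \<epsilon>" and int: "integrable M (\<lambda>\<omega>. exp (\<epsilon> * \<bar>X 1 \<omega>\<bar>))"
    and drift: "expectation (X 1) + c < 0"
  shows "\<exists>\<theta> \<rho>. 0 < \<theta> \<and> 0 \<le> \<rho> \<and> \<rho> < 1 \<and>
    (\<forall>k. (\<integral>\<^sup>+\<omega>. ennreal (exp (\<theta> * (partial_sum X k \<omega> + c * real k))) \<partial>M) = ennreal (\<rho> ^ k))"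
proof -
  have X[measurable]: "X 1 \<in> borel_measurable M"
    using ind by (auto simp: indep_vars_def2)
  have "integrable M (X 1)" using X \<open>0 < \<epsilon>\<close> int by (rule integrable_if_exp_moment)
  then have "expectation (\<lambda>\<omega>. X 1 \<omega> + c) < 0" using drift by (simp add: prob_space)
  moreover have "integrable M (\<lambda>\<omega>. exp (\<epsilon> * \<bar>X 1 \<omega> + c\<bar>))"
  proof (rule Bochner_Integration.integrable_bound)
    show "integrable M (\<lambda>\<omega>. exp (\<epsilon> * \<bar>c\<bar>) * exp (\<epsilon> * \<bar>X 1 \<omega>\<bar>))" using int by simp
    have "exp (\<epsilon> * \<bar>x + c\<bar>) \<le> exp (\<epsilon> * \<bar>c\<bar>) * exp (\<epsilon> * \<bar>x\<bar>)" for x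
      using \<open>0 < \<epsilon>\<close> by (simp flip: exp_add distrib_left)
    then show "AE \<omega> in M. norm (exp (\<epsilon> * \<bar>X 1 \<omega> + c\<bar>)) \<le> norm (exp (\<epsilon> * \<bar>c\<bar>) * exp (\<epsilon> * \<bar>X 1 \<omega>\<bar>))"
      by simp
  qed (use X in measurable)
  moreover have "(\<lambda>\<omega>. X 1 \<omega> + c) \<in> borel_measurable M"
    using X by (rule borel_measurable_add) simp
  ultimately obtain \<theta> where \<theta>: "\<theta> > 0" "integrable M (\<lambda>\<omega>. exp (\<theta> * (X 1 \<omega> + c)))"
      "expectation (\<lambda>\<omega>. exp (\<theta> * (X 1 \<omega> + c))) < 1"
    using exp_moment_less_1[OF _ \<open>0 < \<epsilon>\<close>] by metis
  show ?thesis
    using \<theta>(1,3) nn_integral_exp_partial_sum[OF ind id \<theta>(2)]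
    by (intro exI[of _ \<theta>] exI[of _ "expectation (\<lambda>\<omega>. exp (\<theta> * (X 1 \<omega> + c)))"]) auto
qed

text \<open>By Markov's inequality, the drifted walk exceeds \<open>B\<close> at time
  \<open>k\<close> with probability at most \<open>exp (- \<theta> * B) * \<rho> ^ k\<close>.
  Summing the geometric series bounds the probability of ever exceeding \<open>B\<close>.\<close>

lemma (in prob_space) drift_escape_bound:
  fixes X :: "nat \<Rightarrow> 'a \<Rightarrow> real"
  assumes ind: "indep_vars (\<lambda>_. borel) X {1..}"
    and id: "\<And>j. j \<ge> 1 \<Longrightarrow> distr M borel (X j) = distr M borel (X 1)"
    and "0 < \<epsilon>" and int: "integrable M (\<lambda>\<omega>. exp (\<epsilon> * \<bar>X 1 \<omega>\<bar>))"
    and drift: "expectation (X 1) + c < 0" and "0 < \<delta>"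
  shows "\<exists>B\<ge>0. 1 - \<delta> \<le> prob {\<omega>\<in>space M. \<forall>k. partial_sum X k \<omega> + c * real k \<le> B}"
proof -
  have X: "X j \<in> borel_measurable M" if "j \<ge> 1" for j
    using ind that by (auto simp: indep_vars_def2)
  then have S[measurable]: "partial_sum X k \<in> borel_measurable M" for k
    unfolding partial_sum_def by (intro borel_measurable_sum) auto
  obtain \<theta> \<rho> where \<theta>: "0 < \<theta>" "0 \<le> \<rho>" "\<rho> < 1"
    and mom: "\<And>k. (\<integral>\<^sup>+\<omega>. ennreal (exp (\<theta> * (partial_sum X k \<omega> + c * real k))) \<partial>M) = ennreal (\<rho> ^ k)"
    using drifted_partial_sum_exp_moments[OF ind id \<open>0 < \<epsilon>\<close> int drift] by blast
  \<comment> \<open>Chosen so that the geometric sum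
    \<open>exp (- \<theta> * B) / (1 - \<rho>)\<close> is at most \<open>\<delta>\<close>; the
    maximum with 0 only ensures \<open>0 \<le> B\<close>.\<close>
  define B where "B = max 0 (- ln (\<delta> * (1 - \<rho>)) / \<theta>)"
  have "0 \<le> B" by (simp add: B_def)
  have "- ln (\<delta> * (1 - \<rho>)) \<le> \<theta> * B"
    using \<theta> by (simp add: B_def max_def field_simps)
  then have "exp (- \<theta> * B) \<le> exp (ln (\<delta> * (1 - \<rho>)))" by simp
  then have B: "exp (- \<theta> * B) / (1 - \<rho>) \<le> \<delta>"
    using \<theta> \<open>0 < \<delta>\<close> by (simp add: field_simps)
  let ?bad = "\<lambda>k. {\<omega>\<in>space M. B < partial_sum X k \<omega> + c * real k}"
  have bad: "emeasure M (?bad k) \<le> ennreal (exp (- \<theta> * B) * \<rho> ^ k)" for k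
  proof -
    have "emeasure M (?bad k) = (\<integral>\<^sup>+\<omega>. indicator (?bad k) \<omega> \<partial>M)" by simp
    also have "\<dots> \<le> (\<integral>\<^sup>+\<omega>. ennreal (exp (- \<theta> * B)) * ennreal (exp (\<theta> * (partial_sum X k \<omega> + c * real k))) \<partial>M)"
    proof (intro nn_integral_mono)
      fix \<omega>
      have "1 \<le> exp (- \<theta> * B) * exp (\<theta> * (partial_sum X k \<omega> + c * real k))"
        if "B < partial_sum X k \<omega> + c * real k"
        using mult_left_mono[OF less_imp_le[OF that], of \<theta>] \<theta> by (simp flip: exp_add)
      then show "indicator (?bad k) \<omega> \<le> ennreal (exp (- \<theta> * B)) * ennreal (exp (\<theta> * (partial_sum X k \<omega> + c * real k)))"
        by (auto simp: indicator_def simp flip: ennreal_mult)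
    qed
    also have "\<dots> = ennreal (exp (- \<theta> * B)) * ennreal (\<rho> ^ k)"
      by (subst nn_integral_cmult) (auto simp: mom)
    finally show ?thesis using \<theta> by (simp add: ennreal_mult)
  qed
  have "emeasure M (\<Union>k. ?bad k) \<le> (\<Sum>k. emeasure M (?bad k))"
    by (intro emeasure_subadditive_countably) auto
  also have "\<dots> \<le> (\<Sum>k. ennreal (exp (- \<theta> * B) * \<rho> ^ k))"
    using bad by (intro suminf_le) auto
  also have "\<dots> = ennreal (\<Sum>k. exp (- \<theta> * B) * \<rho> ^ k)"
    using \<theta> by (intro suminf_ennreal2) (auto intro!: summable_mult summable_geometric)
  also have "(\<Sum>k. exp (- \<theta> * B) * \<rho> ^ k) = exp (- \<theta> * B) / (1 - \<rho>)"
    using \<theta> by (subst suminf_mult) (auto simp: suminf_geometric summable_geometric)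
  also have "ennreal \<dots> \<le> ennreal \<delta>" using B by (rule ennreal_leI)
  finally have "prob (\<Union>k. ?bad k) \<le> \<delta>"
    using \<open>0 < \<delta>\<close> by (simp add: emeasure_eq_measure)
  moreover have "{\<omega>\<in>space M. \<forall>k. partial_sum X k \<omega> + c * real k \<le> B} = space M - (\<Union>k. ?bad k)"
    by (auto simp flip: not_le)
  moreover have "prob (space M - (\<Union>k. ?bad k)) = 1 - prob (\<Union>k. ?bad k)"
    by (rule prob_compl) auto
  ultimately show ?thesis using \<open>0 \<le> B\<close> by (intro exI[of _ B]) auto
qed

subsection \<open>Tails with vanishing hazard rate\<close>

text \<open>This is not the convolution definition of subexponential distributions: it says that,
  far enough out, \<open>G\<close> loses at most a factor \<open>exp (- \<epsilon> * y)\<close> over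
  any distance \<open>y\<close>. It is the integrated form of a hazard rate tending to 0.\<close>

definition subexp_tail :: "(real \<Rightarrow> real) \<Rightarrow> bool" where
  "subexp_tail G \<longleftrightarrow> (\<forall>\<epsilon>>0. \<exists>x0. \<forall>x\<ge>x0. \<forall>y\<ge>0. exp (- \<epsilon> * y) * G x \<le> G (x + y))"

section \<open>Tail functions of random variables and their rate of decay\<close>

lemma (in prob_space) upper_tail_antimono:
  assumes [measurable]: "Y \<in> borel_measurable M"
  shows "antimono (upper_tail M Y)"
  unfolding upper_tail_def by (intro antimonoI finite_measure_mono) auto

lemma (in prob_space) upper_tail_le_1: "upper_tail M Y x \<le> 1"
  by (simp add: upper_tail_def)

lemma (in prob_space) upper_tail_eq_distr:
  assumes [measurable]: "Y \<in> borel_measurable M"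
  shows "upper_tail M Y x = measure (distr M borel Y) {x<..}"
  by (subst measure_distr) (auto simp: upper_tail_def intro!: arg_cong[where f="measure M"])

lemma (in prob_space) upper_tail_tendsto_0:
  fixes Y :: "'a \<Rightarrow> real"
  assumes [measurable]: "Y \<in> borel_measurable M"
  shows "(upper_tail M Y \<longlongrightarrow> 0) at_top"
proof -
  interpret D: real_distribution "distr M borel Y" by simp
  have "((\<lambda>x. 1 - cdf (distr M borel Y) x) \<longlongrightarrow> 1 - 1) at_top"
    by (intro tendsto_intros D.cdf_lim_at_top_prob)
  moreover have "upper_tail M Y x = 1 - cdf (distr M borel Y) x" for x
  proof -
    have "{x<..} = space (distr M borel Y) - {..x}" by auto
    then show ?thesis
      using D.prob_compl[of "{..x}"] by (simp add: upper_tail_eq_distr cdf_def)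
  qed
  then have "upper_tail M Y = (\<lambda>x. 1 - cdf (distr M borel Y) x)" by (rule ext)
  ultimately show ?thesis by simp
qed

text \<open>The mass of \<open>(x, x + y]\<close> is the integral of the density
  \<open>p u = h u * G u\<close>, and there \<open>h u \<le> \<epsilon>\<close> and
  \<open>G u \<le> G x\<close>. This first-order estimate replaces solving the differential equation
  for the tail.\<close>

lemma (in prob_space) upper_tail_step:
  assumes haz: "has_hazard_rate M Y h"
    and "0 \<le> \<epsilon>" "0 \<le> y" and h: "\<And>u. x \<le> u \<Longrightarrow> h u \<le> \<epsilon>"
  shows "(1 - \<epsilon> * y) * upper_tail M Y x \<le> upper_tail M Y (x + y)"
proof -
  obtain p where p: "\<And>x. 0 \<le> p x" "distributed M lborel Y (\<lambda>x. ennreal (p x))"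
     "\<And>x. 0 < upper_tail M Y x" "\<And>x. h x = p x / upper_tail M Y x"
    using haz unfolding has_hazard_rate_def by auto
  have Y[measurable]: "Y \<in> borel_measurable M"
    using distributed_measurable[OF p(2)] by simp
  let ?G = "upper_tail M Y"
  have "ennreal (?G x - ?G (x + y)) = emeasure M {\<omega>\<in>space M. x < Y \<omega> \<and> Y \<omega> \<le> x + y}"
  proof -
    have "?G x - ?G (x + y) = prob ({\<omega>\<in>space M. Y \<omega> > x} - {\<omega>\<in>space M. Y \<omega> > x + y})"
      unfolding upper_tail_def using \<open>0 \<le> y\<close> by (intro finite_measure_Diff[symmetric]) auto
    also have "{\<omega>\<in>space M. Y \<omega> > x} - {\<omega>\<in>space M. Y \<omega> > x + y} = {\<omega>\<in>space M. x < Y \<omega> \<and> Y \<omega> \<le> x + y}"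
      by auto
    finally show ?thesis by (simp add: emeasure_eq_measure)
  qed
  also have "\<dots> = emeasure M (Y -` {x<..x+y} \<inter> space M)"
    by (intro arg_cong2[where f=emeasure]) auto
  also have "\<dots> = (\<integral>\<^sup>+u\<in>{x<..x+y}. ennreal (p u) \<partial>lborel)"
    using distributed_emeasure[OF p(2), of "{x<..x+y}"] by (simp add: mult.commute)
  also have "\<dots> \<le> (\<integral>\<^sup>+u. ennreal (\<epsilon> * ?G x) * indicator {x<..x+y} u \<partial>lborel)"
  proof (rule nn_integral_mono)
    fix u
    have "p u \<le> \<epsilon> * ?G x" if "x \<le> u"
    proof -
      have "p u = h u * ?G u" using p(3)[of u] p(4)[of u] by simp
      also have "\<dots> \<le> \<epsilon> * ?G x"
        using h[OF that] p(3)[of u] \<open>0 \<le> \<epsilon>\<close> antimonoD[OF upper_tail_antimono[OF Y] that]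
        by (intro mult_mono) auto
      finally show ?thesis .
    qed
    then show "ennreal (p u) * indicator {x<..x+y} u \<le> ennreal (\<epsilon> * ?G x) * indicator {x<..x+y} u"
      by (auto simp: indicator_def intro!: ennreal_leI)
  qed
  also have "\<dots> = ennreal (\<epsilon> * ?G x) * ennreal y"
    using \<open>0 \<le> y\<close> by (subst nn_integral_cmult_indicator) auto
  also have "\<dots> = ennreal (\<epsilon> * ?G x * y)"
    using \<open>0 \<le> y\<close> \<open>0 \<le> \<epsilon>\<close> p(3)[of x] by (subst ennreal_mult) auto
  finally have "?G x - ?G (x + y) \<le> \<epsilon> * ?G x * y"
    using \<open>0 \<le> y\<close> \<open>0 \<le> \<epsilon>\<close> p(3)[of x] by (subst (asm) ennreal_le_iff) auto
  then show ?thesis by (simp add: algebra_simps)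
qed

text \<open>The linear estimate gives the exponential one over short distances; a long distance is
  cut into equal short pieces and the factors multiply.\<close>

lemma (in prob_space) upper_tail_subexp:
  assumes haz: "has_hazard_rate M Y h" and h: "(h \<longlongrightarrow> 0) at_top"
  shows "subexp_tail (upper_tail M Y)"
  unfolding subexp_tail_def
proof (intro allI impI)
  fix \<epsilon> :: real assume "0 < \<epsilon>"
  let ?G = "upper_tail M Y"
  \<comment> \<open>Half of \<open>\<epsilon>\<close> is the slack needed to pass from the linear
    factor \<open>1 - \<epsilon> / 2 * y\<close> to \<open>exp (- \<epsilon> * y)\<close>.\<close>
  obtain x0 where x0: "\<And>u. x0 \<le> u \<Longrightarrow> h u < \<epsilon> / 2"
    using order_tendstoD(2)[OF h, of "\<epsilon> / 2"] \<open>0 < \<epsilon>\<close> by (auto simp: eventually_at_top_linorder)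
  have Gpos: "?G u > 0" for u using haz by (auto simp: has_hazard_rate_def)
  have small: "exp (- \<epsilon> * y) * ?G x \<le> ?G (x + y)" if "x0 \<le> x" "0 \<le> y" "\<epsilon> * y \<le> 1" for x y
  proof -
    have "exp (- \<epsilon> * y) \<le> 1 - \<epsilon> / 2 * y"
    proof -
      have "\<epsilon> * y \<ge> 0" using that \<open>0 < \<epsilon>\<close> by simp
      \<comment> \<open>With \<open>s = \<epsilon> * y\<close> the right side is
        \<open>1 + s * (1 - s) / 2\<close>, so the bound uses
        \<open>0 \<le> s \<le> 1\<close>.\<close>
      have "1 \<le> (1 - \<epsilon> * y / 2) * (1 + \<epsilon> * y)"
        using mult_left_mono[OF that(3) \<open>\<epsilon> * y \<ge> 0\<close>] by (simp add: algebra_simps)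
      also have "\<dots> \<le> (1 - \<epsilon> * y / 2) * exp (\<epsilon> * y)"
        using that by (intro mult_left_mono) auto
      finally show ?thesis by (simp add: exp_minus field_simps)
    qed
    then have "exp (- \<epsilon> * y) * ?G x \<le> (1 - \<epsilon> / 2 * y) * ?G x"
      using Gpos[of x] by (intro mult_right_mono) auto
    also have "\<dots> \<le> ?G (x + y)"
      using that \<open>0 < \<epsilon>\<close> less_imp_le[OF x0] by (intro upper_tail_step[OF haz]) auto
    finally show ?thesis .
  qed
  have iter: "exp (- \<epsilon> * (real n * y)) * ?G x \<le> ?G (x + real n * y)"
    if "x0 \<le> x" "0 \<le> y" "\<epsilon> * y \<le> 1" for x y and n :: nat
  proof (induction n)
    case (Suc n)
    have "exp (- \<epsilon> * (real (Suc n) * y)) * ?G x = exp (- \<epsilon> * y) * (exp (- \<epsilon> * (real n * y)) * ?G x)"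
      by (simp add: algebra_simps flip: exp_add)
    also have "\<dots> \<le> exp (- \<epsilon> * y) * ?G (x + real n * y)"
      by (intro mult_left_mono Suc) auto
    also have "\<dots> \<le> ?G (x + real n * y + y)"
      using that by (intro small) (auto intro: add_increasing2)
    finally show ?case by (simp add: algebra_simps)
  qed auto
  show "\<exists>x0. \<forall>x\<ge>x0. \<forall>y\<ge>0. exp (- \<epsilon> * y) * ?G x \<le> ?G (x + y)"
  proof (intro exI[of _ x0] allI impI)
    fix x y :: real assume "x0 \<le> x" "0 \<le> y"
    \<comment> \<open>So many pieces that each has length \<open>y / n\<close> with
      \<open>\<epsilon> * (y / n) \<le> 1\<close>.\<close>
    obtain n :: nat where n: "\<epsilon> * y < real n" using reals_Archimedean2 by blast
    have "0 < real n" using n \<open>0 \<le> y\<close> \<open>0 < \<epsilon>\<close> by (meson le_less_trans less_imp_le mult_nonneg_nonneg)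
    then show "exp (- \<epsilon> * y) * ?G x \<le> ?G (x + y)"
      using iter[OF \<open>x0 \<le> x\<close>, of "y / real n" n] n \<open>0 \<le> y\<close> by simp
  qed
qed

subsection \<open>Integrated tails\<close>

lemma set_nn_integral_antimono_interval:
  fixes G :: "real \<Rightarrow> real"
  assumes "antimono G" "\<And>x. 0 \<le> G x" "a \<le> b"
  shows "(\<integral>\<^sup>+y\<in>{a..<b}. ennreal (G y) \<partial>lborel) \<le> ennreal ((b - a) * G a)" (is "?I \<le> _")
    and "ennreal ((b - a) * G b) \<le> (\<integral>\<^sup>+y\<in>{a..<b}. ennreal (G y) \<partial>lborel)"
proof -
  have const: "(\<integral>\<^sup>+y. ennreal r * indicator {a..<b} y \<partial>lborel) = ennreal ((b - a) * r)" if "0 \<le> r" for r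
    using that \<open>a \<le> b\<close> by (subst nn_integral_cmult_indicator) (auto simp: ennreal_mult mult.commute)
  have "?I \<le> (\<integral>\<^sup>+y. ennreal (G a) * indicator {a..<b} y \<partial>lborel)"
    using antimonoD[OF assms(1)] by (intro nn_integral_mono) (auto simp: indicator_def intro!: ennreal_leI)
  then show "?I \<le> ennreal ((b - a) * G a)" using const assms by simp
  have "(\<integral>\<^sup>+y. ennreal (G b) * indicator {a..<b} y \<partial>lborel) \<le> ?I"
    using antimonoD[OF assms(1)] by (intro nn_integral_mono) (auto simp: indicator_def intro!: ennreal_leI)
  then show "ennreal ((b - a) * G b) \<le> ?I" using const assms by simp
qed

text \<open>The half-open blocks of length \<open>c\<close> tile the half-line, and the measure with
  density \<open>f\<close> is countably additive. Values in \<open>ennreal\<close> allow infinite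
  integrals, so the identity is available before integrability of the tail is known.\<close>

lemma set_nn_integral_atLeast_split:
  fixes f :: "real \<Rightarrow> ennreal"
  assumes [measurable]: "f \<in> borel_measurable lborel" and "0 < c"
  shows "(\<integral>\<^sup>+y\<in>{x..}. f y \<partial>lborel)
    = (\<Sum>k. \<integral>\<^sup>+y\<in>{x + c * real k..<x + c * real (Suc k)}. f y \<partial>lborel)"
proof -
  let ?A = "\<lambda>k::nat. {x + c * real k..<x + c * real (Suc k)}"
  have floor: "k = nat \<lfloor>(y - x) / c\<rfloor>" if "y \<in> ?A k" for k y
  proof -
    have "\<lfloor>(y - x) / c\<rfloor> = int k"
      using that \<open>0 < c\<close> by (intro floor_unique) (auto simp: field_simps)
    then show ?thesis by simp
  qed
  have disj: "disjoint_family ?A"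
    unfolding disjoint_family_on_def using floor by blast
  have Un: "(\<Union>k. ?A k) = {x..}"
  proof (intro set_eqI iffI)
    fix y assume "y \<in> {x..}"
    then have y: "0 \<le> (y - x) / c" using \<open>0 < c\<close> by simp
    define k where "k = nat \<lfloor>(y - x) / c\<rfloor>"
    have "real k \<le> (y - x) / c" "(y - x) / c < real k + 1"
      using y unfolding k_def by linarith+
    then have "y \<in> ?A k" using \<open>0 < c\<close> by (auto simp: field_simps)
    then show "y \<in> (\<Union>k. ?A k)" by blast
  next
    fix y assume "y \<in> (\<Union>k. ?A k)"
    then obtain k where "y \<in> ?A k" by blast
    moreover have "0 \<le> c * real k" using \<open>0 < c\<close> by simp
    ultimately show "y \<in> {x..}" by auto
  qed
  have "(\<Sum>k. emeasure (density lborel f) (?A k)) = emeasure (density lborel f) (\<Union>k. ?A k)"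
    by (intro suminf_emeasure disj) auto
  then show ?thesis unfolding Un by (simp add: emeasure_density)
qed

section \<open>Comparison of a slowly decaying tail's sums with its integral\<close>

locale subexponential_tail =
  fixes G :: "real \<Rightarrow> real"
  assumes anti: "antimono G" and pos: "\<And>x. 0 < G x" and subexp: "subexp_tail G"
begin

lemma nonneg: "0 \<le> G x" using pos by (rule less_imp_le)

lemma borel[measurable]: "G \<in> borel_measurable borel"
  using borel_measurable_mono[of "\<lambda>x. - G x"] anti
  by (simp add: mono_def antimono_def)

lemma borel_ennreal: "(\<lambda>x. ennreal (G x)) \<in> borel_measurable lborel"
  by measurable

lemma nn_integral_le_suminf:
  assumes "0 < c"
  shows "(\<integral>\<^sup>+y\<in>{x..}. ennreal (G y) \<partial>lborel) \<le> (\<Sum>k. ennreal (c * G (x + c * real k)))"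
  unfolding set_nn_integral_atLeast_split[OF borel_ennreal assms]
proof (intro suminf_le)
  fix k :: nat
  show "(\<integral>\<^sup>+y\<in>{x + c * real k..<x + c * real (Suc k)}. ennreal (G y) \<partial>lborel) \<le> ennreal (c * G (x + c * real k))"
    using set_nn_integral_antimono_interval(1)[OF anti nonneg, of "x + c * real k" "x + c * real (Suc k)"] assms
    by (simp add: algebra_simps)
qed auto

text \<open>On each block \<open>G\<close> is at least its value at the right endpoint, hence the
  index \<open>Suc k\<close>; the opposite comparison uses left endpoints and starts at 0.\<close>

lemma suminf_le_nn_integral:
  assumes "0 < c"
  shows "(\<Sum>k. ennreal (c * G (x + c * real (Suc k)))) \<le> (\<integral>\<^sup>+y\<in>{x..}. ennreal (G y) \<partial>lborel)"
  unfolding set_nn_integral_atLeast_split[OF borel_ennreal assms]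
proof (intro suminf_le)
  fix k :: nat
  show "ennreal (c * G (x + c * real (Suc k))) \<le> (\<integral>\<^sup>+y\<in>{x + c * real k..<x + c * real (Suc k)}. ennreal (G y) \<partial>lborel)"
    using set_nn_integral_antimono_interval(2)[OF anti nonneg, of "x + c * real k" "x + c * real (Suc k)"] assms
    by (simp add: algebra_simps)
qed auto

text \<open>Convergence along one progression transfers to any other starting point with the same
  step: after \<open>m\<close> steps the new progression lies to the right of the old one, and
  finitely many terms do not matter.\<close>

lemma integrable_if_summable:
  assumes "0 < c" "summable (\<lambda>k. G (x0 + c * real k))"
  shows "set_integrable lborel {x..} G"
proof -
  obtain m :: nat where m: "(x0 - x) / c < real m" using reals_Archimedean2 by blast
  have "summable (\<lambda>k. G (x + c * real k))"
  proof (subst summable_iff_shift[symmetric, of _ m], rule summable_comparison_test')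
    fix k :: nat
    have "x0 + c * real k \<le> x + c * real (k + m)"
      using m \<open>0 < c\<close> by (simp add: field_simps)
    then show "norm (G (x + c * real (k + m))) \<le> G (x0 + c * real k)"
      using nonneg antimonoD[OF anti] by simp
  qed (use assms in auto)
  then have "summable (\<lambda>k. c * G (x + c * real k))" by (intro summable_mult)
  then have "(\<Sum>k. ennreal (c * G (x + c * real k))) < \<infinity>"
    using \<open>0 < c\<close> nonneg by (subst suminf_ennreal2) auto
  then have "(\<integral>\<^sup>+y\<in>{x..}. ennreal (G y) \<partial>lborel) < \<infinity>"
    using nn_integral_le_suminf[OF \<open>0 < c\<close>, of x] by (rule le_less_trans[rotated])
  then show ?thesis
    unfolding set_integrable_def
  proof (intro integrableI_bounded)
    have "(\<integral>\<^sup>+y. ennreal (norm (indicator {x..} y *\<^sub>R G y)) \<partial>lborel) = (\<integral>\<^sup>+y\<in>{x..}. ennreal (G y) \<partial>lborel)"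
      using nonneg by (intro nn_integral_cong) (auto simp: indicator_def)
    also assume "\<dots> < \<infinity>"
    finally show "(\<integral>\<^sup>+y. ennreal (norm (indicator {x..} y *\<^sub>R G y)) \<partial>lborel) < \<infinity>" .
  qed simp
qed

end

text \<open>Integrability is kept apart from the other assumptions because for the perturbed walk it
  is itself derived, from finiteness of the maximum.\<close>

locale integrable_subexponential_tail = subexponential_tail +
  assumes integrable: "\<And>x. set_integrable lborel {x..} G"
begin

definition V :: "real \<Rightarrow> real" where "V x = (LBINT y:{x..}. G y)"

lemma V_nn_integral: "ennreal (V x) = (\<integral>\<^sup>+y\<in>{x..}. ennreal (G y) \<partial>lborel)"
proof -
  have "(\<integral>\<^sup>+y\<in>{x..}. ennreal (G y) \<partial>lborel) = (\<integral>\<^sup>+y. ennreal (indicator {x..} y *\<^sub>R G y) \<partial>lborel)"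
    by (intro nn_integral_cong) (auto simp: indicator_def)
  also have "\<dots> = ennreal (V x)"
    using integrable[of x] nonneg unfolding V_def set_lebesgue_integral_def set_integrable_def
    by (intro nn_integral_eq_integral) auto
  finally show ?thesis ..
qed

lemma V_nonneg: "0 \<le> V x"
  unfolding V_def set_lebesgue_integral_def using nonneg by (intro integral_nonneg_AE) auto

lemma summable: "0 < c \<Longrightarrow> summable (\<lambda>k. G (x + c * real k))"
proof -
  assume c: "0 < c"
  have "(\<Sum>k. ennreal (c * G (x + c * real (Suc k)))) < \<infinity>"
    using suminf_le_nn_integral[OF c, of x] V_nn_integral[of x] by (metis ennreal_less_top infinity_ennreal_def le_less_trans)
  then have "summable (\<lambda>k. c * G (x + c * real (Suc k)))"
    using c nonneg by (intro summable_suminf_not_top) auto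
  then have "summable (\<lambda>k. G (x + c * real (Suc k)))"
    using c by (subst (asm) summable_cmult_iff) auto
  then show ?thesis by (subst (asm) summable_Suc_iff)
qed

lemma V_le_suminf:
  assumes "0 < c"
  shows "V x \<le> c * (\<Sum>k. G (x + c * real k))"
proof -
  have "ennreal (V x) \<le> (\<Sum>k. ennreal (c * G (x + c * real k)))"
    unfolding V_nn_integral by (rule nn_integral_le_suminf[OF assms])
  also have "\<dots> = ennreal (\<Sum>k. c * G (x + c * real k))"
    using assms nonneg summable by (intro suminf_ennreal2) auto
  also have "(\<Sum>k. c * G (x + c * real k)) = c * (\<Sum>k. G (x + c * real k))"
    using summable[OF assms] by (rule suminf_mult)
  finally show ?thesis
    using assms nonneg summable by (subst (asm) ennreal_le_iff) (auto intro!: suminf_nonneg mult_nonneg_nonneg)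
qed

text \<open>The summand \<open>G x\<close> is the term \<open>k = 0\<close>, which the
  right-endpoint comparison does not cover. It is asymptotically negligible against
  \<open>V x\<close>.\<close>

lemma suminf_le_V:
  assumes "0 < c"
  shows "(\<Sum>k. G (x + c * real k)) \<le> G x + V x / c"
proof -
  have s: "summable (\<lambda>k. G (x + c * real (Suc k)))"
    by (subst summable_Suc_iff) (rule summable[OF assms])
  have "ennreal (\<Sum>k. c * G (x + c * real (Suc k))) = (\<Sum>k. ennreal (c * G (x + c * real (Suc k))))"
    using assms nonneg s by (intro suminf_ennreal2[symmetric]) auto
  also have "\<dots> \<le> ennreal (V x)"
    unfolding V_nn_integral by (rule suminf_le_nn_integral[OF assms])
  finally have "c * (\<Sum>k. G (x + c * real (Suc k))) \<le> V x"
    using V_nonneg suminf_mult[OF s, of c] by (subst (asm) ennreal_le_iff) auto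
  moreover have "(\<Sum>k. G (x + c * real k)) = (\<Sum>k. G (x + c * real (Suc k))) + G x"
    using suminf_split_head[OF summable[OF assms], of x] by simp
  ultimately show ?thesis using assms by (simp add: field_simps)
qed

lemma V_split:
  assumes "a \<le> b"
  shows "ennreal (V a) = (\<integral>\<^sup>+y\<in>{a..<b}. ennreal (G y) \<partial>lborel) + ennreal (V b)"
proof -
  have "{a..} = {a..<b} \<union> {b..}" using assms by auto
  then show ?thesis
    unfolding V_nn_integral
    by (subst nn_integral_disjoint_pair[symmetric]) auto
qed

lemma V_ge: "0 \<le> L \<Longrightarrow> L * G (x + L) \<le> V x"
proof -
  assume "0 \<le> L"
  then have "ennreal (L * G (x + L)) \<le> ennreal (V x)"
    using V_split[of x "x + L"] set_nn_integral_antimono_interval(2)[OF anti nonneg, of x "x + L"]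
    by (simp add: add_increasing2)
  then show ?thesis using V_nonneg by (simp add: ennreal_le_iff)
qed

lemma V_pos: "0 < V x"
  using V_ge[of 1 x] pos[of "x + 1"] by simp

lemma V_antimono: "antimono V"
proof (rule antimonoI)
  fix a b :: real assume "a \<le> b"
  then have "ennreal (V b) \<le> ennreal (V a)" using V_split[of a b] by simp
  then show "V b \<le> V a" using V_nonneg by (simp add: ennreal_le_iff)
qed

lemma V_shift_le:
  assumes "0 \<le> B"
  shows "V (x - B) \<le> V x + B * G (x - B)"
proof -
  have "ennreal (V (x - B)) \<le> ennreal (B * G (x - B)) + ennreal (V x)"
    using V_split[of "x - B" x] set_nn_integral_antimono_interval(1)[OF anti nonneg, of "x - B" x] assms
    by (simp add: add_right_mono)
  also have "\<dots> = ennreal (V x + B * G (x - B))"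
    using assms nonneg V_nonneg by (subst ennreal_plus[symmetric]) (auto simp: add.commute)
  finally show ?thesis
    using assms nonneg V_nonneg by (subst (asm) ennreal_le_iff) auto
qed

section \<open>Asymptotic insensitivity of the integrated tail to shifts\<close>

lemma V_tendsto_0: "(V \<longlongrightarrow> 0) at_top"
proof -
  have "((\<lambda>x. \<integral>y. indicator {x..} y *\<^sub>R G y \<partial>lborel) \<longlongrightarrow> integral\<^sup>L lborel (\<lambda>_::real. 0)) at_top"
  proof (rule integral_dominated_convergence_at_top[where w="\<lambda>y. indicator {0..} y *\<^sub>R G y"])
    show "AE y in lborel. ((\<lambda>x. indicator {x..} y *\<^sub>R G y) \<longlongrightarrow> 0) at_top"
    proof (rule AE_I2)
      fix y :: real
      have "eventually (\<lambda>x. indicator {x..} y *\<^sub>R G y = 0) at_top"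
        using eventually_gt_at_top[of y] by eventually_elim auto
      then show "((\<lambda>x. indicator {x..} y *\<^sub>R G y) \<longlongrightarrow> 0) at_top"
        by (rule tendsto_eventually)
    qed
    show "\<forall>\<^sub>F x in at_top. AE y in lborel. norm (indicator {x..} y *\<^sub>R G y) \<le> indicator {0..} y *\<^sub>R G y"
      using eventually_ge_at_top[of 0]
      by eventually_elim (auto simp: indicator_def nonneg)
  qed (use integrable[of 0] in \<open>auto simp: set_integrable_def\<close>)
  moreover have "V = (\<lambda>x. \<integral>y. indicator {x..} y *\<^sub>R G y \<partial>lborel)"
    by (rule ext) (simp only: V_def set_lebesgue_integral_def)
  ultimately show ?thesis by simp
qed

text \<open>\<open>V x\<close> is at least \<open>L * G (x + L)\<close>, and slow decay makes
  \<open>G (x + L)\<close> comparable to \<open>G (x - B)\<close> however large \<open>L\<close> is.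
  Hence the ratio is eventually at most \<open>exp 1 / L\<close>.\<close>

lemma G_over_V_tendsto_0: "((\<lambda>x. G (x - B) / V x) \<longlongrightarrow> 0) at_top" if "0 \<le> B"
proof (rule order_tendstoI)
  show "\<forall>\<^sub>F x in at_top. a < G (x - B) / V x" if "a < 0" for a
    using that pos V_pos by (intro always_eventually allI) (meson divide_pos_pos less_trans)
next
  fix a :: real assume "0 < a"
  define L where "L = 2 * exp 1 / a"
  have L: "0 < L" "exp 1 / L < a" using \<open>0 < a\<close> by (auto simp: L_def field_simps)
  \<comment> \<open>The rate \<open>1 / (L + B)\<close> makes the loss over the distance
    \<open>L + B\<close> exactly a factor \<open>exp 1\<close>.\<close>
  obtain x0 where x0: "\<And>x y. x0 \<le> x \<Longrightarrow> 0 \<le> y \<Longrightarrow> exp (- (1 / (L + B)) * y) * G x \<le> G (x + y)"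
    using subexp[unfolded subexp_tail_def, rule_format, of "1 / (L + B)"] \<open>0 \<le> B\<close> L by auto
  show "\<forall>\<^sub>F x in at_top. G (x - B) / V x < a"
    using eventually_ge_at_top[of "x0 + B"]
  proof eventually_elim
    case (elim x)
    have "exp (- 1) * G (x - B) \<le> G (x + L)"
      using x0[of "x - B" "L + B"] elim \<open>0 \<le> B\<close> L by simp
    then have "L * (exp (- 1) * G (x - B)) \<le> V x"
      using V_ge[of L x] L by (meson less_imp_le mult_left_mono order_trans)
    then have "G (x - B) / V x \<le> exp 1 / L"
      using V_pos[of x] L by (simp add: exp_minus field_simps)
    then show ?case using L by simp
  qed
qed

text \<open>Shifting by \<open>B\<close> adds the integral over an interval of length
  \<open>B\<close>, at most \<open>B * G (x - B)\<close>, which is negligible against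
  \<open>V x\<close>.\<close>

lemma V_shift_minus: "((\<lambda>x. V (x - B) / V x) \<longlongrightarrow> 1) at_top" if "0 \<le> B"
proof (rule tendsto_sandwich)
  show "\<forall>\<^sub>F x in at_top. 1 \<le> V (x - B) / V x"
    using V_pos antimonoD[OF V_antimono] that by (intro always_eventually allI) simp
  show "\<forall>\<^sub>F x in at_top. V (x - B) / V x \<le> 1 + B * (G (x - B) / V x)"
  proof (intro always_eventually allI)
    fix x
    show "V (x - B) / V x \<le> 1 + B * (G (x - B) / V x)"
      using divide_right_mono[OF V_shift_le[OF that, of x] V_nonneg[of x]] V_pos[of x]
      by (simp add: add_divide_distrib)
  qed
  show "((\<lambda>x. 1 + B * (G (x - B) / V x)) \<longlongrightarrow> 1) at_top"
    using tendsto_add[OF tendsto_const tendsto_mult[OF tendsto_const G_over_V_tendsto_0[OF that]], of 1 B]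
    by simp
qed simp

lemma V_shift_plus: "((\<lambda>x. V (x + B) / V x) \<longlongrightarrow> 1) at_top" if "0 \<le> B"
proof -
  have "filterlim (\<lambda>x. x + B) at_top at_top"
    using filterlim_tendsto_add_at_top[OF tendsto_const[of B] filterlim_ident] by (simp add: add.commute)
  from filterlim_compose[OF V_shift_minus[OF that] this]
  have "((\<lambda>x. inverse (V x / V (x + B))) \<longlongrightarrow> inverse 1) at_top"
    by (intro tendsto_inverse) auto
  then show ?thesis by simp
qed

end

subsection \<open>The perturbed walk\<close>

text \<open>The probability that no threshold is exceeded is the product of the
  \<open>1 - upper_tail M (Y k) (a k)\<close>, each at most the exponential of minus the tail. The
  bound is asymptotic to the sum of the tails when that sum is small, and tends to 1 when it
  diverges.\<close>

lemma (in prob_space) prob_exceed_ge: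
  fixes Y :: "nat \<Rightarrow> 'a \<Rightarrow> real"
  assumes ind: "indep_vars (\<lambda>_. borel) Y UNIV"
  shows "1 - exp (- (\<Sum>k<N. upper_tail M (Y k) (a k))) \<le> prob {\<omega>\<in>space M. \<exists>k<N. a k < Y k \<omega>}"
\<comment> \<open>The intersection over an empty index set is the whole type rather than
  \<open>space M\<close>, so this case is separate.\<close>
proof (cases "N = 0")
  case False
  have Y[measurable]: "Y k \<in> borel_measurable M" for k
    using ind by (auto simp: indep_vars_def2)
  have compl: "prob (Y k -` {..a k} \<inter> space M) = 1 - upper_tail M (Y k) (a k)" for k
  proof -
    have "Y k -` {..a k} \<inter> space M = space M - {\<omega>\<in>space M. Y k \<omega> > a k}" by auto
    then show ?thesis using prob_compl[of "{\<omega>\<in>space M. Y k \<omega> > a k}"] by (simp add: upper_tail_def)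
  qed
  have "prob (\<Inter>k\<in>{..<N}. Y k -` {..a k} \<inter> space M) = (\<Prod>k<N. 1 - upper_tail M (Y k) (a k))"
    using False by (subst indep_varsD[OF ind]) (auto simp: compl)
  also have "\<dots> \<le> (\<Prod>k<N. exp (- upper_tail M (Y k) (a k)))"
  proof (intro prod_mono conjI)
    fix k
    show "0 \<le> 1 - upper_tail M (Y k) (a k)" using upper_tail_le_1[of "Y k"] by simp
    show "1 - upper_tail M (Y k) (a k) \<le> exp (- upper_tail M (Y k) (a k))"
      using exp_ge_add_one_self[of "- upper_tail M (Y k) (a k)"] by simp
  qed
  also have "\<dots> = exp (- (\<Sum>k<N. upper_tail M (Y k) (a k)))"
    by (simp add: exp_sum flip: sum_negf)
  finally have "prob (\<Inter>k\<in>{..<N}. Y k -` {..a k} \<inter> space M) \<le> exp (- (\<Sum>k<N. upper_tail M (Y k) (a k)))" .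
  moreover have "(\<Inter>k\<in>{..<N}. Y k -` {..a k} \<inter> space M) = space M - {\<omega>\<in>space M. \<exists>k<N. a k < Y k \<omega>}"
    using False by (auto simp: not_less)
  moreover have "prob (space M - {\<omega>\<in>space M. \<exists>k<N. a k < Y k \<omega>}) = 1 - prob {\<omega>\<in>space M. \<exists>k<N. a k < Y k \<omega>}"
    by (rule prob_compl) measurable
  ultimately show ?thesis by simp
qed simp

text \<open>Conditioning on \<open>S\<close>: by independence the joint law is a product measure,
  and the slice over \<open>s\<close> is the half-line above \<open>x - s\<close>.\<close>

lemma (in prob_space) emeasure_indep_sum_gt:
  fixes S Y :: "'a \<Rightarrow> real"
  assumes ind: "indep_var borel S borel Y"
  shows "emeasure M {\<omega>\<in>space M. x < S \<omega> + Y \<omega>} = (\<integral>\<^sup>+\<omega>. ennreal (upper_tail M Y (x - S \<omega>)) \<partial>M)"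
proof -
  have S[measurable]: "S \<in> borel_measurable M" and Y[measurable]: "Y \<in> borel_measurable M"
    using ind by (auto dest: indep_var_rv1 indep_var_rv2)
  interpret DY: prob_space "distr M borel Y" by (rule prob_space_distr) simp
  have eq: "distr M (borel \<Otimes>\<^sub>M borel) (\<lambda>\<omega>. (S \<omega>, Y \<omega>)) = distr M borel S \<Otimes>\<^sub>M distr M borel Y"
    using ind by (simp add: indep_var_distribution_eq)
  let ?A = "{z :: real \<times> real. x < fst z + snd z}"
  have A[measurable]: "?A \<in> sets (borel \<Otimes>\<^sub>M borel)"
  proof -
    have "{z \<in> space (borel \<Otimes>\<^sub>M borel). x < fst z + snd z} \<in> sets (borel \<Otimes>\<^sub>M borel)"
      by measurable
    then show ?thesis by (simp add: space_pair_measure)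
  qed
  have "emeasure M {\<omega>\<in>space M. x < S \<omega> + Y \<omega>} = emeasure (distr M (borel \<Otimes>\<^sub>M borel) (\<lambda>\<omega>. (S \<omega>, Y \<omega>))) ?A"
    by (subst emeasure_distr) (auto intro!: arg_cong2[where f=emeasure])
  also have "\<dots> = (\<integral>\<^sup>+s. emeasure (distr M borel Y) (Pair s -` ?A) \<partial>distr M borel S)"
    unfolding eq by (rule DY.emeasure_pair_measure_alt) simp
  also have "\<dots> = (\<integral>\<^sup>+s. ennreal (upper_tail M Y (x - s)) \<partial>distr M borel S)"
  proof (intro nn_integral_cong)
    fix s
    have "Pair s -` ?A = {x - s<..}" by auto
    then show "emeasure (distr M borel Y) (Pair s -` ?A) = ennreal (upper_tail M Y (x - s))"
      by (simp add: upper_tail_eq_distr DY.emeasure_eq_measure)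
  qed
  also have "\<dots> = (\<integral>\<^sup>+\<omega>. ennreal (upper_tail M Y (x - S \<omega>)) \<partial>M)"
  proof (rule nn_integral_distr)
    have "upper_tail M Y \<in> borel_measurable borel"
      using borel_measurable_mono[of "\<lambda>x. - upper_tail M Y x"] upper_tail_antimono[OF Y]
      by (simp add: mono_def antimono_def)
    then show "(\<lambda>s. ennreal (upper_tail M Y (x - s))) \<in> borel_measurable (distr M borel S)"
      by simp
  qed simp
  finally show ?thesis .
qed

text \<open>\<open>M_max\<close> states that, almost surely, the real number
  \<open>M \<omega>\<close> is an attained maximum. Dominance of all terms gives the lower bound on
  its tail, attainment gives the union bound.\<close>

locale perturbed_random_walk = prob_space P for P :: "'a measure" +
  fixes X \<xi> :: "nat \<Rightarrow> 'a \<Rightarrow> real" and M :: "'a \<Rightarrow> real" and h :: "real \<Rightarrow> real" and \<epsilon> :: real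
  assumes X_indep: "indep_vars (\<lambda>_. borel) X {1..}"
    and X_distr: "\<And>j. j \<ge> 1 \<Longrightarrow> distr P borel (X j) = distr P borel (X 1)"
    and \<epsilon>_pos: "0 < \<epsilon>" and X_exp: "integrable P (\<lambda>\<omega>. exp (\<epsilon> * \<bar>X 1 \<omega>\<bar>))"
    and X_neg: "expectation (X 1) < 0"
    and \<xi>_indep: "indep_vars (\<lambda>_. borel) \<xi> UNIV"
    and \<xi>_distr: "\<And>j. distr P borel (\<xi> j) = distr P borel (\<xi> 1)"
    and indep: "indep_var
           (\<Pi>\<^sub>M j\<in>UNIV. borel) (\<lambda>\<omega> j. partial_sum X j \<omega>)
           (\<Pi>\<^sub>M j\<in>UNIV. borel) (\<lambda>\<omega> j. \<xi> j \<omega>)"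
    and hazard: "has_hazard_rate P (\<xi> 1) h" and h_lim: "(h \<longlongrightarrow> 0) at_top"
    and M_meas[measurable]: "M \<in> borel_measurable P"
    and M_max: "AE \<omega> in P. M \<omega> \<in> range (\<lambda>k. partial_sum X k \<omega> + \<xi> k \<omega>) \<and>
                    (\<forall>k. partial_sum X k \<omega> + \<xi> k \<omega> \<le> M \<omega>)"
begin

abbreviation "G \<equiv> upper_tail P (\<xi> 1)"

lemma X_meas: "j \<ge> 1 \<Longrightarrow> X j \<in> borel_measurable P"
  using X_indep by (auto simp: indep_vars_def2)

lemma S_meas[measurable]: "partial_sum X k \<in> borel_measurable P"
  unfolding partial_sum_def using X_meas by (intro borel_measurable_sum) auto

lemma \<xi>_meas[measurable]: "\<xi> k \<in> borel_measurable P"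
  using \<xi>_indep by (auto simp: indep_vars_def2)

lemma \<xi>_tail: "upper_tail P (\<xi> k) = G"
proof
  fix x
  show "upper_tail P (\<xi> k) x = G x"
    unfolding upper_tail_eq_distr[OF \<xi>_meas] by (subst \<xi>_distr) rule
qed

sublocale subexponential_tail G
proof
  show "antimono G" by (rule upper_tail_antimono) simp
  show "0 < G x" for x using hazard by (auto simp: has_hazard_rate_def)
  show "subexp_tail G" using hazard h_lim by (rule upper_tail_subexp)
qed

text \<open>One event, on the walk alone, keeps it above the line \<open>- c * k - B\<close> for
  ever (the escape bound for the reflected walk \<open>- X\<close>); the other, on
  \<open>\<xi>\<close> alone, lifts some \<open>\<xi> k\<close> above \<open>x + B + c * k\<close>.
  They are independent and together force \<open>x < M\<close>. With finitely many \<open>k\<close>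
  the estimate does not presuppose that \<open>G\<close> is integrable.\<close>

lemma lower_bound:
  assumes "- expectation (X 1) < c" "0 < \<delta>"
  shows "\<exists>B\<ge>0. \<forall>x N. (1 - \<delta>) * (1 - exp (- (\<Sum>k<N. G (x + B + c * real k)))) \<le> upper_tail P M x"
proof -
  have neg_indep: "indep_vars (\<lambda>_. borel) (\<lambda>j \<omega>. - X j \<omega>) {1..}"
    using X_indep by (rule indep_vars_compose2) simp
  have neg_distr: "distr P borel (\<lambda>\<omega>. - X j \<omega>) = distr P borel (\<lambda>\<omega>. - X 1 \<omega>)" if "j \<ge> 1" for j
  proof -
    have "distr P borel (\<lambda>\<omega>. - X i \<omega>) = distr (distr P borel (X i)) borel uminus" if "i \<ge> 1" for i
      using X_meas[OF that] by (subst distr_distr) (auto simp: comp_def)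
    then show ?thesis using X_distr[OF that] that by simp
  qed
  have neg_exp: "integrable P (\<lambda>\<omega>. exp (\<epsilon> * \<bar>- X 1 \<omega>\<bar>))" using X_exp by simp
  have neg_drift: "expectation (\<lambda>\<omega>. - X 1 \<omega>) + - c < 0" using assms by simp
  obtain B where "0 \<le> B" and
    B: "1 - \<delta> \<le> prob {\<omega>\<in>space P. \<forall>k. partial_sum (\<lambda>j \<omega>. - X j \<omega>) k \<omega> + - c * real k \<le> B}"
    using drift_escape_bound[of "\<lambda>j \<omega>. - X j \<omega>", OF neg_indep neg_distr \<epsilon>_pos neg_exp neg_drift \<open>0 < \<delta>\<close>]
    by auto
  show ?thesis
  proof (intro exI[of _ B] conjI allI \<open>0 \<le> B\<close>)
    fix x and N :: nat
    let ?\<Pi> = "\<Pi>\<^sub>M j\<in>(UNIV :: nat set). (borel :: real measure)"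
    let ?A = "{f \<in> space ?\<Pi>. \<forall>k. - c * real k - B \<le> f k}"
    let ?C = "{f \<in> space ?\<Pi>. \<exists>k<N. x + B + c * real k < f k}"
    let ?a = "(\<lambda>\<omega> j. partial_sum X j \<omega>) -` ?A \<inter> space P"
    let ?b = "(\<lambda>\<omega> j. \<xi> j \<omega>) -` ?C \<inter> space P"
    have sets: "?A \<in> sets ?\<Pi>" "?C \<in> sets ?\<Pi>" by measurable
    have a: "?a = {\<omega>\<in>space P. \<forall>k. - c * real k - B \<le> partial_sum X k \<omega>}"
      and b: "?b = {\<omega>\<in>space P. \<exists>k<N. x + B + c * real k < \<xi> k \<omega>}"
      by (auto simp: space_PiM)
    have "1 - \<delta> \<le> prob ?a"
    proof -
      have "{\<omega>\<in>space P. \<forall>k. partial_sum (\<lambda>j \<omega>. - X j \<omega>) k \<omega> + - c * real k \<le> B} = ?a"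
        unfolding a by (intro Collect_cong conj_cong refl all_cong1)
          (auto simp: partial_sum_def sum_negf)
      with B show ?thesis by simp
    qed
    moreover have "1 - exp (- (\<Sum>k<N. G (x + B + c * real k))) \<le> prob ?b"
    proof -
      have "(\<Sum>k<N. upper_tail P (\<xi> k) (x + B + c * real k)) = (\<Sum>k<N. G (x + B + c * real k))"
        by (intro sum.cong refl fun_cong[OF \<xi>_tail])
      then show ?thesis
        unfolding b using prob_exceed_ge[OF \<xi>_indep, where N=N and a="\<lambda>k. x + B + c * real k"]
        by (simp only:)
    qed
    moreover have "0 \<le> (\<Sum>k<N. G (x + B + c * real k))" by (intro sum_nonneg nonneg)
    ultimately have "(1 - \<delta>) * (1 - exp (- (\<Sum>k<N. G (x + B + c * real k)))) \<le> prob ?a * prob ?b"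
      by (intro mult_mono) auto
    also have "\<dots> = prob ((\<lambda>\<omega>. (\<lambda>j. partial_sum X j \<omega>, \<lambda>j. \<xi> j \<omega>)) -` (?A \<times> ?C) \<inter> space P)"
      using indep_varD[OF indep sets] by simp
    also have "(\<lambda>\<omega>. (\<lambda>j. partial_sum X j \<omega>, \<lambda>j. \<xi> j \<omega>)) -` (?A \<times> ?C) \<inter> space P = ?a \<inter> ?b"
      by auto
    also have "prob (?a \<inter> ?b) \<le> upper_tail P M x"
      unfolding upper_tail_def
    proof (rule finite_measure_mono_AE)
      show "AE \<omega> in P. \<omega> \<in> ?a \<inter> ?b \<longrightarrow> \<omega> \<in> {\<omega>\<in>space P. x < M \<omega>}"
        using M_max
      proof eventually_elim
        case (elim \<omega>)
        show ?case
        proof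
          assume "\<omega> \<in> ?a \<inter> ?b"
          then obtain k where "\<omega> \<in> space P" "- c * real k - B \<le> partial_sum X k \<omega>" "x + B + c * real k < \<xi> k \<omega>"
            unfolding a b by auto
          moreover have "partial_sum X k \<omega> + \<xi> k \<omega> \<le> M \<omega>" using elim by blast
          ultimately show "\<omega> \<in> {\<omega>\<in>space P. x < M \<omega>}" by simp
        qed
      qed
    qed simp
    finally show "(1 - \<delta>) * (1 - exp (- (\<Sum>k<N. G (x + B + c * real k)))) \<le> upper_tail P M x" .
  qed
qed

text \<open>If the sums of \<open>G\<close> along a progression were unbounded, the lower bound
  would keep the tail of \<open>M\<close> at 1/2 or more everywhere, whereas \<open>M\<close> is
  real-valued and its tail tends to 0.\<close>

lemma G_integrable: "set_integrable lborel {x..} G"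
proof -
  define c where "c = 1 - expectation (X 1)"
  have "0 < c" using X_neg by (simp add: c_def)
  obtain B where B: "\<And>x N. (1 - 1/2) * (1 - exp (- (\<Sum>k<N. G (x + B + c * real k)))) \<le> upper_tail P M x"
    using lower_bound[of c "1/2"] by (auto simp: c_def)
  \<comment> \<open>With \<open>\<delta> = 1/2\<close> in the lower bound, a tail below 1/4 forces
    the exponential to be at least 1/2, so every partial sum is at most \<open>ln 2\<close>.\<close>
  obtain x0 where x0: "upper_tail P M x0 < 1/4"
    using order_tendstoD(2)[OF upper_tail_tendsto_0[OF M_meas], of "1/4"]
    by (auto simp: eventually_at_top_linorder)
  have "(\<Sum>k<N. G (x0 + B + c * real k)) \<le> ln 2" for N
  proof -
    have "1/2 \<le> exp (- (\<Sum>k<N. G (x0 + B + c * real k)))"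
      using B[of x0 N] x0 by simp
    then have "ln (1/2) \<le> ln (exp (- (\<Sum>k<N. G (x0 + B + c * real k))))"
      by (subst ln_le_cancel_iff) auto
    then show ?thesis by (simp add: ln_div)
  qed
  then have "summable (\<lambda>k. G (x0 + B + c * real k))"
    by (intro summableI_nonneg_bounded nonneg)
  then show ?thesis by (rule integrable_if_summable[OF \<open>0 < c\<close>])
qed

sublocale integrable_subexponential_tail G
  by unfold_locales (rule G_integrable)

text \<open>With \<open>a = x - B + c * k\<close> and \<open>z = S + c * k - B\<close>, where
  \<open>S\<close> is the walk at time \<open>k\<close>, the \<open>k\<close>-th term has tail
  probability equal to the expectation of \<open>G (a - z)\<close>. This is at most
  \<open>G a\<close> plus a correction whose expectation is at most \<open>\<delta> * G a\<close>;
  the union bound then leaves the sum treated in \<open>suminf_le_V\<close>.\<close>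

lemma upper_bound:
  assumes "0 < c" "c < - expectation (X 1)" "0 < \<delta>"
  shows "\<exists>B\<ge>0. \<forall>\<^sub>F x in at_top. upper_tail P M x \<le> (1 + \<delta>) * (G (x - B) + V (x - B) / c)"
proof -
  have "expectation (X 1) + c < 0" using assms by simp
  then obtain \<theta> \<rho> where \<theta>: "0 < \<theta>" "0 \<le> \<rho>" "\<rho> < 1"
    and mom: "\<And>k. (\<integral>\<^sup>+\<omega>. ennreal (exp (\<theta> * (partial_sum X k \<omega> + c * real k))) \<partial>P) = ennreal (\<rho> ^ k)"
    using drifted_partial_sum_exp_moments[OF X_indep X_distr \<epsilon>_pos X_exp] by blast
  obtain x0 where x0: "\<And>x y. x0 \<le> x \<Longrightarrow> 0 \<le> y \<Longrightarrow> exp (- \<theta> * y) * G x \<le> G (x + y)"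
    using subexp[unfolded subexp_tail_def] \<theta>(1) by meson
  \<comment> \<open>Chosen so that \<open>exp (- \<theta> * B) / G x0 \<le> \<delta>\<close>; this
    is the relative size of the correction before the factor \<open>\<rho> ^ k\<close>.\<close>
  define B where "B = max 0 (- ln (\<delta> * G x0) / \<theta>)"
  have "0 \<le> B" by (simp add: B_def)
  have "- ln (\<delta> * G x0) / \<theta> \<le> B" by (simp add: B_def)
  then have "- ln (\<delta> * G x0) \<le> \<theta> * B"
    using \<theta> by (simp add: field_simps)
  then have "exp (- \<theta> * B) \<le> exp (ln (\<delta> * G x0))" by simp
  also have "\<dots> = \<delta> * G x0" using pos[of x0] \<open>0 < \<delta>\<close> by (intro exp_ln) simp
  finally have B: "exp (- \<theta> * B) / G x0 \<le> \<delta>"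
    using pos[of x0] \<open>0 < \<delta>\<close> by (simp add: field_simps)
  have G_shift_le: "G (a - z) \<le> G a + G a * (exp (\<theta> * z) / G x0)" if "x0 \<le> a" for a z
  proof -
    have nn: "0 \<le> G a * (exp (\<theta> * z) / G x0)" using nonneg by simp
    consider "z \<le> 0" | "0 < z" "x0 \<le> a - z" | "0 < z" "a - z < x0" by linarith
    then show ?thesis
    proof cases
      case 1
      then show ?thesis using antimonoD[OF anti, of a "a - z"] nn by simp
    next
      case 2
      have "G (a - z) \<le> G a * exp (\<theta> * z)"
        using x0[of "a - z" z] 2 by (simp add: exp_minus field_simps)
      also have "\<dots> \<le> G a * (exp (\<theta> * z) / G x0)"
        using pos[of x0] upper_tail_le_1[of "\<xi> 1" x0] nonneg
        by (intro mult_left_mono) (auto simp: field_simps)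
      finally show ?thesis using nonneg[of a] by simp
    next
      case 3
      define t where "t = \<theta> * (a - x0)"
      have "exp (- t) * G x0 \<le> G a"
        using x0[of x0 "a - x0"] that by (simp add: t_def)
      then have "G x0 \<le> G a * exp t" by (simp add: exp_minus field_simps)
      also have "\<dots> \<le> G a * exp (\<theta> * z)"
        using 3 \<theta> nonneg by (intro mult_left_mono) (auto simp: t_def)
      finally have "1 \<le> G a * (exp (\<theta> * z) / G x0)" using pos[of x0] by (simp add: field_simps)
      then show ?thesis using upper_tail_le_1[of "\<xi> 1" "a - z"] nonneg[of a] by linarith
    qed
  qed
  have each: "emeasure P {\<omega>\<in>space P. x < partial_sum X k \<omega> + \<xi> k \<omega>} \<le> ennreal ((1 + \<delta>) * G (x - B + c * real k))"
    if "x0 + B \<le> x" for x k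
  proof -
    let ?a = "x - B + c * real k" and ?S = "partial_sum X k"
    have "x0 \<le> ?a" using that \<open>0 < c\<close> by (simp add: add_increasing2)
    have "indep_var borel ((\<lambda>f. f k) \<circ> (\<lambda>\<omega> j. partial_sum X j \<omega>)) borel ((\<lambda>f. f k) \<circ> (\<lambda>\<omega> j. \<xi> j \<omega>))"
      by (rule indep_var_compose[OF indep]) measurable
    then have "indep_var borel ?S borel (\<xi> k)" by (simp add: comp_def)
    then have "emeasure P {\<omega>\<in>space P. x < ?S \<omega> + \<xi> k \<omega>} = (\<integral>\<^sup>+\<omega>. ennreal (G (x - ?S \<omega>)) \<partial>P)"
      using emeasure_indep_sum_gt \<xi>_tail by metis
    also have "\<dots> \<le> (\<integral>\<^sup>+\<omega>. ennreal (G ?a) + ennreal (G ?a * (exp (- \<theta> * B) / G x0)) * ennreal (exp (\<theta> * (?S \<omega> + c * real k))) \<partial>P)"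
    proof (rule nn_integral_mono)
      fix \<omega>
      have "G (x - ?S \<omega>) \<le> G ?a + G ?a * (exp (\<theta> * (?S \<omega> + c * real k - B)) / G x0)"
        using G_shift_le[OF \<open>x0 \<le> ?a\<close>, of "?S \<omega> + c * real k - B"] by simp
      also have "\<dots> = G ?a + G ?a * (exp (- \<theta> * B) / G x0) * exp (\<theta> * (?S \<omega> + c * real k))"
        by (simp add: right_diff_distrib exp_diff exp_minus field_simps)
      finally show "ennreal (G (x - ?S \<omega>)) \<le> ennreal (G ?a) + ennreal (G ?a * (exp (- \<theta> * B) / G x0)) * ennreal (exp (\<theta> * (?S \<omega> + c * real k)))"
        using nonneg by (subst ennreal_mult[symmetric] ennreal_plus[symmetric]; simp add: ennreal_leI del: ennreal_plus)+
    qed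
    also have "\<dots> = ennreal (G ?a) + ennreal (G ?a * (exp (- \<theta> * B) / G x0)) * ennreal (\<rho> ^ k)"
      by (subst nn_integral_add, simp, simp, subst nn_integral_cmult) (auto simp: mom emeasure_space_1)
    also have "\<dots> = ennreal (G ?a + G ?a * (exp (- \<theta> * B) / G x0) * \<rho> ^ k)"
      using nonneg \<theta> by (simp flip: ennreal_mult ennreal_plus)
    also have "\<dots> \<le> ennreal ((1 + \<delta>) * G ?a)"
    proof (rule ennreal_leI)
      \<comment> \<open>Bounding \<open>\<rho> ^ k\<close> by 1 makes the relative error uniform in
        \<open>k\<close>.\<close>
      have "exp (- \<theta> * B) / G x0 * \<rho> ^ k \<le> \<delta> * 1"
        using B \<theta> \<open>0 < \<delta>\<close> by (intro mult_mono power_le_one) auto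
      then have "G ?a * (exp (- \<theta> * B) / G x0 * \<rho> ^ k) \<le> G ?a * \<delta>"
        using nonneg by (intro mult_left_mono) auto
      then show "G ?a + G ?a * (exp (- \<theta> * B) / G x0) * \<rho> ^ k \<le> (1 + \<delta>) * G ?a"
        by (simp add: algebra_simps)
    qed
    finally show ?thesis .
  qed
  have "upper_tail P M x \<le> (1 + \<delta>) * (G (x - B) + V (x - B) / c)" if "x0 + B \<le> x" for x
  proof -
    have "ennreal (upper_tail P M x) = emeasure P {\<omega>\<in>space P. x < M \<omega>}"
      by (simp add: upper_tail_def emeasure_eq_measure)
    also have "\<dots> \<le> emeasure P (\<Union>k. {\<omega>\<in>space P. x < partial_sum X k \<omega> + \<xi> k \<omega>})"
    proof (rule emeasure_mono_AE)
      show "AE \<omega> in P. \<omega> \<in> {\<omega>\<in>space P. x < M \<omega>} \<longrightarrow> \<omega> \<in> (\<Union>k. {\<omega>\<in>space P. x < partial_sum X k \<omega> + \<xi> k \<omega>})"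
        using M_max by eventually_elim auto
    qed measurable
    also have "\<dots> \<le> (\<Sum>k. emeasure P {\<omega>\<in>space P. x < partial_sum X k \<omega> + \<xi> k \<omega>})"
      by (rule emeasure_subadditive_countably) auto
    also have "\<dots> \<le> (\<Sum>k. ennreal ((1 + \<delta>) * G (x - B + c * real k)))"
      using each[OF that] by (intro suminf_le) auto
    also have "\<dots> = ennreal (\<Sum>k. (1 + \<delta>) * G (x - B + c * real k))"
      using \<open>0 < \<delta>\<close> nonneg summable[OF \<open>0 < c\<close>] by (intro suminf_ennreal2 summable_mult) auto
    also have "(\<Sum>k. (1 + \<delta>) * G (x - B + c * real k)) = (1 + \<delta>) * (\<Sum>k. G (x - B + c * real k))"
      by (rule suminf_mult[OF summable[OF \<open>0 < c\<close>]])
    also have "ennreal \<dots> \<le> ennreal ((1 + \<delta>) * (G (x - B) + V (x - B) / c))"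
      using \<open>0 < \<delta>\<close> suminf_le_V[OF \<open>0 < c\<close>] by (intro ennreal_leI mult_left_mono) auto
    finally show ?thesis
      using \<open>0 < \<delta>\<close> \<open>0 < c\<close> nonneg V_nonneg by (subst (asm) ennreal_le_iff) auto
  qed
  then show ?thesis
    using \<open>0 \<le> B\<close> by (intro exI[of _ B]) (auto simp: eventually_at_top_linorder)
qed

section \<open>Passage to the limit in the two bounds\<close>

lemma ratio_lower:
  assumes "a < 1"
  shows "\<forall>\<^sub>F x in at_top. a < upper_tail P M x / (V x / - expectation (X 1))"
proof -
  define \<mu> where "\<mu> = - expectation (X 1)"
  have "0 < \<mu>" using X_neg by (simp add: \<mu>_def)
  \<comment> \<open>One \<open>\<delta>\<close> controls both losses: the factor
    \<open>1 - \<delta>\<close> from the escape event and \<open>1 + \<delta>\<close> from the slope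
    \<open>c = (1 + \<delta>) * \<mu>\<close>.\<close>
  have "((\<lambda>\<delta>. (1 - \<delta>) / (1 + \<delta>)) \<longlongrightarrow> (1 - 0) / (1 + 0)) (at_right (0::real))"
    by (intro tendsto_intros) auto
  then have "\<forall>\<^sub>F \<delta> in at_right 0. a < (1 - \<delta>) / (1 + \<delta>)"
    using assms by (intro order_tendstoD(1)) auto
  moreover have "\<forall>\<^sub>F \<delta> in at_right 0. \<delta> \<in> {0<..<1::real}"
    by (rule eventually_at_right_real) simp
  ultimately obtain \<delta> where \<delta>: "a < (1 - \<delta>) / (1 + \<delta>)" "0 < \<delta>" "\<delta> < 1"
    using eventually_happens'[OF trivial_limit_at_right_real eventually_conj] by fastforce
  define c where "c = (1 + \<delta>) * \<mu>"
  have c: "0 < c" "\<mu> < c" using \<delta> \<open>0 < \<mu>\<close> by (auto simp: c_def)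
  obtain B where B: "0 \<le> B"
    "\<And>x N. (1 - \<delta>) * (1 - exp (- (\<Sum>k<N. G (x + B + c * real k)))) \<le> upper_tail P M x"
    using lower_bound[of c \<delta>] c \<delta> by (auto simp: \<mu>_def)
  define t where "t x = V (x + B) / c" for x
  have tpos: "0 < t x" for x using V_pos c by (simp add: t_def)
  have lower: "(1 - \<delta>) * (1 - exp (- t x)) \<le> upper_tail P M x" for x
  proof -
    \<comment> \<open>Integrability of \<open>G\<close> is now known, so \<open>N\<close> may tend
      to infinity and the sum be replaced by the integrated tail.\<close>
    have "(\<lambda>N. (1 - \<delta>) * (1 - exp (- (\<Sum>k<N. G (x + B + c * real k))))) \<longlonglongrightarrow>
        (1 - \<delta>) * (1 - exp (- (\<Sum>k. G (x + B + c * real k))))"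
      by (intro tendsto_intros summable_LIMSEQ summable c)
    then have "(1 - \<delta>) * (1 - exp (- (\<Sum>k. G (x + B + c * real k)))) \<le> upper_tail P M x"
      using B(2) by (intro LIMSEQ_le_const2) auto
    moreover have "t x \<le> (\<Sum>k. G (x + B + c * real k))"
      using V_le_suminf[OF c(1), of "x + B"] c by (simp add: t_def field_simps)
    then have "(1 - \<delta>) * (1 - exp (- t x)) \<le> (1 - \<delta>) * (1 - exp (- (\<Sum>k. G (x + B + c * real k))))"
      using \<delta> by (intro mult_left_mono) auto
    ultimately show ?thesis by linarith
  qed
  have "(1 - \<delta>) / (1 + \<delta>) * (1 - t x) * (V (x + B) / V x) \<le> upper_tail P M x / (V x / \<mu>)" for x
  proof -
    have "t x * (1 - t x) \<le> 1 - exp (- t x)"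
    proof -
      have "t x \<ge> 0" using tpos[of x] by simp
      \<comment> \<open>The product is \<open>1 + t^3\<close> with \<open>t = t x\<close>; this
        yields \<open>exp (- t) \<le> 1 - t + t * t\<close>.\<close>
      have "1 \<le> (1 - t x + t x * t x) * (1 + t x)"
        using \<open>t x \<ge> 0\<close> by (simp add: algebra_simps)
      also have "\<dots> \<le> (1 - t x + t x * t x) * exp (t x)"
        using sum_squares_ge_zero[of "t x - 1/2" 0] by (intro mult_left_mono) (auto simp: algebra_simps)
      finally show ?thesis by (simp add: exp_minus field_simps)
    qed
    then have "(1 - \<delta>) * (t x * (1 - t x)) \<le> (1 - \<delta>) * (1 - exp (- t x))"
      using \<delta> by (intro mult_left_mono) auto
    also have "\<dots> \<le> upper_tail P M x" by (rule lower)
    finally have "(1 - \<delta>) * (t x * (1 - t x)) / (V x / \<mu>) \<le> upper_tail P M x / (V x / \<mu>)"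
      using V_pos[of x] \<open>0 < \<mu>\<close> by (intro divide_right_mono) auto
    also have "(1 - \<delta>) * (t x * (1 - t x)) / (V x / \<mu>) = (1 - \<delta>) * (1 - t x) * (t x / (V x / \<mu>))"
      by simp
    also have "t x / (V x / \<mu>) = (V (x + B) / V x) / (1 + \<delta>)"
      using \<open>0 < \<mu>\<close> V_pos[of x] \<delta> by (simp add: t_def c_def)
    finally show ?thesis by (simp add: mult_ac)
  qed
  moreover have "\<forall>\<^sub>F x in at_top. a < (1 - \<delta>) / (1 + \<delta>) * (1 - t x) * (V (x + B) / V x)"
  proof (rule order_tendstoD(1))
    have "filterlim (\<lambda>x. x + B) at_top at_top"
      using filterlim_tendsto_add_at_top[OF tendsto_const[of B] filterlim_ident] by (simp add: add.commute)
    from filterlim_compose[OF V_tendsto_0 this] have "(t \<longlongrightarrow> 0 / c) at_top"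
      unfolding t_def using c by (intro tendsto_intros) auto
    then show "((\<lambda>x. (1 - \<delta>) / (1 + \<delta>) * (1 - t x) * (V (x + B) / V x)) \<longlongrightarrow> (1 - \<delta>) / (1 + \<delta>) * (1 - 0 / c) * 1) at_top"
      by (intro tendsto_intros V_shift_plus B)
  qed (use \<delta> in simp)
  ultimately show ?thesis
    unfolding \<mu>_def by (auto elim!: eventually_mono intro: less_le_trans)
qed

text \<open>Dividing the upper bound by \<open>V x / \<mu>\<close>, with slope
  \<open>c = (1 - \<delta>) * \<mu>\<close>, makes its \<open>G\<close> term vanish and its
  \<open>V\<close> term tend to \<open>(1 + \<delta>) / (1 - \<delta>)\<close>, which is below
  \<open>a\<close> for the chosen \<open>\<delta>\<close>.\<close>

lemma ratio_upper:
  assumes "1 < a"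
  shows "\<forall>\<^sub>F x in at_top. upper_tail P M x / (V x / - expectation (X 1)) < a"
proof -
  define \<mu> where "\<mu> = - expectation (X 1)"
  have "0 < \<mu>" using X_neg by (simp add: \<mu>_def)
  have "((\<lambda>\<delta>. (1 + \<delta>) / (1 - \<delta>)) \<longlongrightarrow> (1 + 0) / (1 - 0)) (at_right (0::real))"
    by (intro tendsto_intros) auto
  then have "\<forall>\<^sub>F \<delta> in at_right 0. (1 + \<delta>) / (1 - \<delta>) < a"
    using assms by (intro order_tendstoD(2)) auto
  moreover have "\<forall>\<^sub>F \<delta> in at_right 0. \<delta> \<in> {0<..<1::real}"
    by (rule eventually_at_right_real) simp
  ultimately obtain \<delta> where \<delta>: "(1 + \<delta>) / (1 - \<delta>) < a" "0 < \<delta>" "\<delta> < 1"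
    using eventually_happens'[OF trivial_limit_at_right_real eventually_conj] by fastforce
  define c where "c = (1 - \<delta>) * \<mu>"
  have c: "0 < c" "c < \<mu>" using \<delta> \<open>0 < \<mu>\<close> by (auto simp: c_def)
  obtain B where B: "0 \<le> B"
    "\<forall>\<^sub>F x in at_top. upper_tail P M x \<le> (1 + \<delta>) * (G (x - B) + V (x - B) / c)"
    using upper_bound[of c \<delta>] c \<delta> by (auto simp: \<mu>_def)
  have "\<forall>\<^sub>F x in at_top. (1 + \<delta>) * (\<mu> * (G (x - B) / V x) + V (x - B) / V x / (1 - \<delta>)) < a"
  proof (rule order_tendstoD(2))
    show "((\<lambda>x. (1 + \<delta>) * (\<mu> * (G (x - B) / V x) + V (x - B) / V x / (1 - \<delta>))) \<longlongrightarrow> (1 + \<delta>) * (\<mu> * 0 + 1 / (1 - \<delta>))) at_top"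
      using \<delta> by (intro tendsto_intros G_over_V_tendsto_0 V_shift_minus B) auto
  qed (use \<delta> in simp)
  with B(2) show ?thesis
  proof eventually_elim
    case (elim x)
    have "upper_tail P M x / (V x / \<mu>) \<le> (1 + \<delta>) * (G (x - B) + V (x - B) / c) / (V x / \<mu>)"
      using elim(1) V_pos[of x] \<open>0 < \<mu>\<close> by (intro divide_right_mono) auto
    also have "\<dots> = (1 + \<delta>) * (\<mu> * (G (x - B) / V x) + V (x - B) / V x / (1 - \<delta>))"
      using V_pos[of x] \<open>0 < \<mu>\<close> \<delta> by (simp add: c_def field_simps)
    finally show ?case using elim(2) unfolding \<mu>_def by linarith
  qed
qed

theorem tail_asymptotics:
  "((\<lambda>x. upper_tail P M x / (V x / - expectation (X 1))) \<longlongrightarrow> 1) at_top"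
  using ratio_lower ratio_upper by (rule order_tendstoI)

end

theorem theorem4:
  fixes P :: "'a measure"
    and X \<xi> :: "nat \<Rightarrow> 'a \<Rightarrow> real"
    and M :: "'a \<Rightarrow> real"
    and h :: "real \<Rightarrow> real"
  assumes "prob_space P"
    and "prob_space.indep_vars P (\<lambda>_. borel) X {1..}"
    and "\<And>j. j \<ge> 1 \<Longrightarrow> distr P borel (X j) = distr P borel (X 1)"
    and "\<exists>\<epsilon>>0. integrable P (\<lambda>\<omega>. exp (\<epsilon> * \<bar>X 1 \<omega>\<bar>))"
    and "prob_space.expectation P (X 1) < 0"
    and "prob_space.indep_vars P (\<lambda>_. borel) \<xi> UNIV"
    and "\<And>j. distr P borel (\<xi> j) = distr P borel (\<xi> 1)"
    and "prob_space.indep_var P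
           (\<Pi>\<^sub>M j\<in>UNIV. borel) (\<lambda>\<omega> j. partial_sum X j \<omega>)
           (\<Pi>\<^sub>M j\<in>UNIV. borel) (\<lambda>\<omega> j. \<xi> j \<omega>)"
    and "has_hazard_rate P (\<xi> 1) h"
    and "continuous_on UNIV h"
    and "(h \<longlongrightarrow> 0) at_top"
    and "M \<in> borel_measurable P"
    and "AE \<omega> in P. M \<omega> \<in> range (\<lambda>k. partial_sum X k \<omega> + \<xi> k \<omega>) \<and>
                    (\<forall>k. partial_sum X k \<omega> + \<xi> k \<omega> \<le> M \<omega>)"
  shows "((\<lambda>x. upper_tail P M x /
              (1 / \<bar>prob_space.expectation P (X 1)\<bar> *
                 (LBINT y:{x..}. upper_tail P (\<xi> 1) y))) \<longlongrightarrow> 1) at_top"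
proof -
  obtain \<epsilon> where "0 < \<epsilon>" "integrable P (\<lambda>\<omega>. exp (\<epsilon> * \<bar>X 1 \<omega>\<bar>))"
    using assms(4) by blast
  interpret perturbed_random_walk P X \<xi> M h \<epsilon>
    by (intro perturbed_random_walk.intro perturbed_random_walk_axioms.intro) fact+
  \<comment> \<open>The mean is negative, so its absolute value is the
    \<open>- expectation (X 1)\<close> of \<open>tail_asymptotics\<close>.\<close>
  show ?thesis
    using tail_asymptotics assms(5) unfolding V_def by simp
qed

end
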